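(* Let $P$ be a finite polytopal subdivision of a closed manifold. Provided the vertex-facet incidences of $P$, the algorithm FaceIterator visits exactly once all faces of $P$.
   Context: A closed manifold is a compact manifold without boundary. Facets of $P$ are its maximal cells. The vertices of $P$ are labelled $1,\dots,n$ and each face is identified with its set of vertices, so the vertex-facet incidences give the list of facets as subsets of $\{1,\dots,n\}$. The algorithm is applied to the face poset of $P$ with an artificial upper bound $\hat 1$ added, treated as a finite locally branched lattice (a finite lattice in which for every saturated chain $x\prec y\prec z$ there is an element $w\neq y$ with $x<w<z$). Its coatoms are the facets of $P$; the list of ignored sets and the set of ignored atoms are empty. "Visits" means "outputs". Algorithm FaceIterator$(C,I,J)$, where $I$ is a list of subsets of $\{1,\dots,n\}$ (ignored sets), $J\subseteq\{1,\dots,n\}$ (ignored atoms), and $C$ is the list of coatoms not contained in any element of $I$. If $C$ is empty, stop. Otherwise: 1. Let $a$ be the first element of $C$. 2. If $a\cap J=\emptyset$, output $a$. 3. Let $N_1=\{a\cap b : b\in C,\ b\neq a\}$, let $N_2=\{x\in N_1 : x\not\subseteq y \text{ for all } y\in I\}$, and let $N$ be the list (without repetitions) of inclusion-maximal elements of $N_2$. 4. Call FaceIterator$(N, I, J)$ with a copy of $I$ (so that later changes made to $I$ inside this call do not affect the current $I$). 5. Let $C'=\{x\in C : x\not\subseteq a\cup J\}$ and append $a\cup J$ to $I$. 6. Call FaceIterator$(C', I, J)$.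
   Formalization: When the manifold is a single point (P has one vertex), the empty face is not claimed to be visited: there the algorithm outputs only {1}, so the claim fails for the empty face; everything else is still asserted. *)

theory Defs
  imports "HOL-Analysis.Analysis"
begin

definition locally_Euclidean_space :: "nat \<Rightarrow> 'a topology \<Rightarrow> bool" where
  "locally_Euclidean_space d X \<longleftrightarrow>
     (\<forall>x\<in>topspace X. \<exists>U V. openin X U \<and> x \<in> U \<and> openin (Euclidean_space d) V \<and>
        subtopology X U homeomorphic_space subtopology (Euclidean_space d) V)"

definition closed_manifold :: "nat \<Rightarrow> 'a topology \<Rightarrow> bool" where
  "closed_manifold d X \<longleftrightarrow>
     Hausdorff_space X \<and> second_countable X \<and> locally_Euclidean_space d X \<and> compact_space X"

(* A cell c comes with a characteristic homeomorphism \<phi> c from a convex polytope K c onto c;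
   the faces of c are the images of the faces of K c (the empty face and c included). *)

definition cell_faces ::
  "('a set \<Rightarrow> 'b::euclidean_space set) \<Rightarrow> ('a set \<Rightarrow> 'b \<Rightarrow> 'a) \<Rightarrow> 'a set \<Rightarrow> 'a set set" where
  "cell_faces K \<phi> c = {\<phi> c ` F |F. F face_of K c}"

(* The usual axioms of a polytopal complex (closed under passing to faces; two cells meet in a
   common face), for cells lying in the space X instead of in some R^N.  A geometric polytopal
   complex in R^N is the case where K c = c and \<phi> c is the identity.  A complex whose underlying
   space is merely homeomorphic to X is covered by composing with that homeomorphism. *)

definition polytopal_subdivision ::
  "'a topology \<Rightarrow> 'a set set \<Rightarrow> ('a set \<Rightarrow> 'b::euclidean_space set) \<Rightarrow> ('a set \<Rightarrow> 'b \<Rightarrow> 'a) \<Rightarrow> bool"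
  where
  "polytopal_subdivision X P K \<phi> \<longleftrightarrow>
     \<Union>P = topspace X \<and> {} \<in> P \<and>
     (\<forall>c\<in>P. polytope (K c) \<and>
        homeomorphic_map (top_of_set (K c)) (subtopology X c) (\<phi> c)) \<and>
     (\<forall>c\<in>P. cell_faces K \<phi> c \<subseteq> P) \<and>
     (\<forall>c\<in>P. \<forall>c'\<in>P. c \<inter> c' \<in> cell_faces K \<phi> c \<and> c \<inter> c' \<in> cell_faces K \<phi> c')"

definition vertices :: "'a set set \<Rightarrow> 'a set" where
  "vertices P = {v. {v} \<in> P}"

definition facets :: "'a set set \<Rightarrow> 'a set set" where
  "facets P = {c \<in> P. \<forall>c'\<in>P. c \<subseteq> c' \<longrightarrow> c' = c}"

definition vertex_set :: "('a \<Rightarrow> nat) \<Rightarrow> 'a set set \<Rightarrow> 'a set \<Rightarrow> nat set" where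
  "vertex_set lab P c = lab ` (c \<inter> vertices P)"

(* face_iterator C I J out: the call FaceIterator(C, I, J) has a run whose sequence of outputs is
   out.  This is a relation, not a function, because the order of the lists N and C' is left open.
   The arguments of both recursive calls have fewer elements than C, so every run on a
   repetition-free C terminates. *)

inductive face_iterator ::
  "nat set list \<Rightarrow> nat set list \<Rightarrow> nat set \<Rightarrow> nat set list \<Rightarrow> bool" where
  empty: "face_iterator [] I J []"
| step: "\<lbrakk>C = a # D;
     N1 = {a \<inter> b |b. b \<in> set C \<and> b \<noteq> a};
     N2 = {x \<in> N1. \<forall>y\<in>set I. \<not> x \<subseteq> y};
     distinct N; set N = {x \<in> N2. \<forall>y\<in>N2. x \<subseteq> y \<longrightarrow> y = x};
     face_iterator N I J out1;
     distinct C'; set C' = {x \<in> set C. \<not> x \<subseteq> a \<union> J};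
     face_iterator C' (I @ [a \<union> J]) J out2\<rbrakk>
   \<Longrightarrow> face_iterator C I J ((if a \<inter> J = {} then [a] else []) @ out1 @ out2)"

end

theory Submission
  imports Defs "HOL-Homology.Homology"
begin

text \<open>
  Let \<open>L\<close> be the set of vertex sets of faces and let \<open>D\<close> be \<open>L\<close> itself or the part of \<open>L\<close> strictly
  below some element. A call with the maximal elements of \<open>D\<close> not contained in any ignored set
  outputs exactly the elements of \<open>D\<close> not contained in any ignored set: those strictly below the
  first coatom \<open>a\<close> come from the first recursive call, those not below \<open>a\<close> from the second.
  Local branching says that every coatom of \<open>a\<close> is the intersection of \<open>a\<close> with another coatom,
  so the list \<open>N\<close> again consists of maximal elements. Inside a cell, branching holds because a
  nonempty proper face of a polytope is the intersection of the facets containing it; at the top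
  it is the statement that a closed manifold has no boundary, by invariance of domain.
  It fails only for the one-point space, where the empty face lies below a single vertex.
\<close>

section \<open>Correctness under local branching\<close>

text \<open>Both recursive lists are shorter than \<open>C\<close>: \<open>N\<close> consists of
  intersections of \<open>a\<close> with members of the tail, and \<open>C'\<close> loses at least
  \<open>a\<close>. Some order of their elements can always be chosen, so strong induction on the
  length builds a run.\<close>

lemma face_iterator_run_exists:
  "distinct C \<Longrightarrow> \<exists>out. face_iterator C I J out"
proof (induction "length C" arbitrary: C I rule: less_induct)
  case less
  show ?case
  proof (cases C)
    case Nil
    then show ?thesis using face_iterator.empty by blast
  next
    case (Cons a D)
    define N1 where "N1 = {a \<inter> b |b. b \<in> set C \<and> b \<noteq> a}"
    define N2 where "N2 = {x \<in> N1. \<forall>y\<in>set I. \<not> x \<subseteq> y}"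
    define M where "M = {x \<in> N2. \<forall>y\<in>N2. x \<subseteq> y \<longrightarrow> y = x}"
    have N1: "N1 \<subseteq> (\<inter>) a ` set D" using Cons by (auto simp: N1_def)
    then have "M \<subseteq> (\<inter>) a ` set D" by (auto simp: M_def N2_def)
    moreover have "card ((\<inter>) a ` set D) \<le> length D"
      by (meson List.finite_set card_image_le card_length le_trans)
    ultimately have "finite M" "card M \<le> length D"
      by (auto intro: finite_subset order_trans[OF card_mono])
    then obtain N where N: "set N = M" "distinct N" "length N \<le> length D"
      by (metis finite_distinct_list distinct_card)
    define C' where "C' = filter (\<lambda>x. \<not> x \<subseteq> a \<union> J) C"
    have "length C' \<le> length D" "distinct C'"
      using Cons less.prems by (auto simp: C'_def)
    obtain out1 where out1: "face_iterator N I J out1"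
      using less.hyps[of N I] N Cons by auto
    obtain out2 where out2: "face_iterator C' (I @ [a \<union> J]) J out2"
      using less.hyps[of C'] \<open>length C' \<le> length D\<close> \<open>distinct C'\<close> Cons by auto
    have "set C' = {x \<in> set C. \<not> x \<subseteq> a \<union> J}" by (auto simp: C'_def)
    then show ?thesis
      using face_iterator.step[OF Cons N1_def N2_def N(2) N(1)[unfolded M_def] out1 \<open>distinct C'\<close> _ out2]
      by blast
  qed
qed

text \<open>For \<open>D = L\<close> these are the coatoms below the artificial top; for the
  elements strictly below \<open>a\<close> they are the ones covered by \<open>a\<close>.\<close>

definition maximal_in :: "'a set set \<Rightarrow> 'a set \<Rightarrow> bool" where
  "maximal_in D a \<longleftrightarrow> a \<in> D \<and> (\<forall>b\<in>D. a \<subseteq> b \<longrightarrow> b = a)"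

text \<open>No covering relations and no top element: for \<open>D = {x \<in> L. x \<subset> z}\<close> this is branching of the
  chains \<open>x \<subset> a \<subset> z\<close>, and for \<open>D = L\<close> it is branching below the artificial top element.\<close>

definition locally_branched_below :: "'a set set \<Rightarrow> bool" where
  "locally_branched_below D \<longleftrightarrow> (\<forall>a\<in>D. \<forall>x\<in>D. x \<subset> a \<longrightarrow> (\<exists>w\<in>D. w \<noteq> a \<and> x \<subset> w))"

lemma maximal_in_above:
  assumes "finite D" "x \<in> D"
  obtains a where "maximal_in D a" "x \<subseteq> a"
proof -
  obtain a where "a \<in> D" "x \<subseteq> a" "\<forall>b\<in>D. a \<subseteq> b \<longrightarrow> a = b"
    using finite_has_maximal2[OF assms] by blast
  then show ?thesis using that unfolding maximal_in_def by metis
qed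

text \<open>Both \<open>D\<close> and \<open>I\<close> must vary in the induction: the first call
  replaces \<open>D\<close> by the part strictly below \<open>a\<close> and keeps \<open>I\<close>,
  the second keeps \<open>D\<close> and enlarges \<open>I\<close>. Branching below every
  \<open>z\<close> in \<open>L\<close> supplies the branching hypothesis for each new
  \<open>D\<close>.\<close>

lemma face_iterator_visits:
  assumes run: "face_iterator C I J out"
    and "J = {}" "distinct C" and fin: "finite L"
    and Int: "\<And>x y. x \<in> L \<Longrightarrow> y \<in> L \<Longrightarrow> x \<inter> y \<in> L"
    and branched: "\<And>z. z \<in> L \<Longrightarrow> locally_branched_below {x \<in> L. x \<subset> z}"
    and D: "D \<subseteq> L" "\<And>x y. y \<in> D \<Longrightarrow> x \<in> L \<Longrightarrow> x \<subseteq> y \<Longrightarrow> x \<in> D"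
    and "locally_branched_below D"
    and "set C = {a. maximal_in D a \<and> (\<forall>y\<in>set I. \<not> a \<subseteq> y)}"
  shows "distinct out \<and> set out = {x \<in> D. \<forall>y\<in>set I. \<not> x \<subseteq> y}"
  using run \<open>J = {}\<close> \<open>distinct C\<close> D \<open>locally_branched_below D\<close> \<open>set C = _\<close>
proof (induction arbitrary: D rule: face_iterator.induct)
  case (empty I J)
  \<comment> \<open>With no coatom left, every maximal element lies in an ignored set, and so does
    everything below it.\<close>
  have "\<exists>y\<in>set I. x \<subseteq> y" if "x \<in> D" for x
  proof -
    obtain a where "maximal_in D a" "x \<subseteq> a"
      by (rule maximal_in_above[OF finite_subset[OF empty.prems(3) fin] \<open>x \<in> D\<close>])
    moreover from this(1) obtain y where "y \<in> set I" "a \<subseteq> y"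
      using empty.prems(6) by auto
    ultimately show ?thesis by blast
  qed
  then show ?case by auto
next
  case (step C a E N1 N2 I N J out1 C' out2)
  have [simp]: "J = {}" by fact
  have finD: "finite D" using step.prems(3) fin finite_subset by blast
  have C: "set C = {a. maximal_in D a \<and> (\<forall>y\<in>set I. \<not> a \<subseteq> y)}" by fact
  have "a \<in> set C" using step.hyps(1) by simp
  then have a: "maximal_in D a" "\<forall>y\<in>set I. \<not> a \<subseteq> y" "a \<in> D" "a \<in> L"
    using C step.prems(3) by (auto simp: maximal_in_def)
  define B where "B = {x \<in> L. x \<subset> a}"
  have BD: "B \<subseteq> D" using step.prems(4) a(3) by (auto simp: B_def)
  have finB: "finite B" using BD finD finite_subset by blast
  have N1B: "N1 \<subseteq> B"
  proof
    fix x assume "x \<in> N1"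
    then obtain b where b: "x = a \<inter> b" "b \<in> set C" "b \<noteq> a" using step.hyps(2) by blast
    then have "maximal_in D b" using C by blast
    then have "b \<in> L" "\<not> a \<subseteq> b" using step.prems(3) a(3) b(3) a(1) unfolding maximal_in_def by blast+
    then show "x \<in> B" using b(1) Int[OF a(4)] by (auto simp: B_def)
  qed
  \<comment> \<open>Branching gives \<open>w\<close> above \<open>x\<close> other than
    \<open>a\<close>; it lies below some maximal \<open>b\<close>. If \<open>b\<close> were
    \<open>a\<close>, then \<open>w\<close> would be in \<open>B\<close> strictly above the maximal
    \<open>x\<close>. So \<open>a \<inter> b\<close> is in \<open>B\<close>, contains
    \<open>x\<close>, and equals it by maximality.\<close>
  have coatom: "x \<in> N2" if x: "maximal_in B x" "\<forall>y\<in>set I. \<not> x \<subseteq> y" for x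
  proof -
    have xB: "x \<in> B" using x(1) by (simp add: maximal_in_def)
    then have "x \<subset> a" "x \<in> D" using BD by (auto simp: B_def)
    then obtain w where w: "w \<in> D" "w \<noteq> a" "x \<subset> w"
      using step.prems(5)[unfolded locally_branched_below_def, rule_format, OF a(3)] by metis
    obtain b where b: "maximal_in D b" "w \<subseteq> b"
      by (rule maximal_in_above[OF finD w(1)])
    have "b \<noteq> a"
    proof
      assume "b = a"
      then have "w \<in> B" using b(2) w(1,2) step.prems(3) by (auto simp: B_def)
      then show False using x(1) w(3) unfolding maximal_in_def by blast
    qed
    have "\<forall>y\<in>set I. \<not> b \<subseteq> y" using b(2) x(2) w(3) by blast
    then have "b \<in> set C" using C b(1) by blast
    then have "a \<inter> b \<in> N1" using \<open>b \<noteq> a\<close> step.hyps(2) by blast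
    moreover have "x \<subseteq> a \<inter> b" using \<open>x \<subset> a\<close> w(3) b(2) by blast
    then have "a \<inter> b = x"
      using x(1) N1B \<open>a \<inter> b \<in> N1\<close> unfolding maximal_in_def by blast
    ultimately show ?thesis using step.hyps(3) x(2) by blast
  qed
  have "set N = {x. maximal_in B x \<and> (\<forall>y\<in>set I. \<not> x \<subseteq> y)}"
  proof (intro Set.set_eqI iffI)
    fix x assume "x \<in> set N"
    then have x: "x \<in> N2" "\<And>y. y \<in> N2 \<Longrightarrow> x \<subseteq> y \<Longrightarrow> y = x" using step.hyps(5) by auto
    then have xB: "x \<in> B" and xI: "\<forall>y\<in>set I. \<not> x \<subseteq> y" using N1B step.hyps(3) by auto
    \<comment> \<open>A maximal \<open>m\<close> above \<open>x\<close> is not ignored either,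
      because any ignored set containing \<open>m\<close> would contain \<open>x\<close>. Hence
      \<open>m\<close> is in \<open>N2\<close>, which forces \<open>x = m\<close>.\<close>
    obtain m where m: "maximal_in B m" "x \<subseteq> m" by (rule maximal_in_above[OF finB xB])
    then have "m \<in> N2" using coatom xI by blast
    then show "x \<in> {x. maximal_in B x \<and> (\<forall>y\<in>set I. \<not> x \<subseteq> y)}"
      using x(2) m xI by blast
  next
    fix x assume "x \<in> {x. maximal_in B x \<and> (\<forall>y\<in>set I. \<not> x \<subseteq> y)}"
    then have x: "maximal_in B x" "\<forall>y\<in>set I. \<not> x \<subseteq> y" by auto
    have "N2 \<subseteq> B" using N1B step.hyps(3) by auto
    then have "\<forall>y\<in>N2. x \<subseteq> y \<longrightarrow> y = x" using x(1) unfolding maximal_in_def by auto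
    then show "x \<in> set N"
      using coatom[OF x] step.hyps(5) by simp
  qed
  moreover have "locally_branched_below B"
    using branched[OF a(4)] by (simp add: B_def)
  ultimately have out1: "distinct out1" "set out1 = {x \<in> B. \<forall>y\<in>set I. \<not> x \<subseteq> y}"
    using step.IH(1)[OF \<open>J = {}\<close> \<open>distinct N\<close>, of B] by (auto simp: B_def)
  have "set C' = {b. maximal_in D b \<and> (\<forall>y\<in>set (I @ [a \<union> J]). \<not> b \<subseteq> y)}"
    using step.hyps(8) C by auto
  then have out2: "distinct out2" "set out2 = {x \<in> D. \<forall>y\<in>set (I @ [a \<union> J]). \<not> x \<subseteq> y}"
    using step.IH(2)[OF \<open>J = {}\<close> \<open>distinct C'\<close> step.prems(3,4,5)] by auto
  \<comment> \<open>This splits the output: \<open>a\<close> is output directly, \<open>B\<close> is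
    covered by the first call, and whatever is not below \<open>a\<close> by the second, which
    ignores \<open>a\<close>.\<close>
  have "D \<inter> {x. x \<subseteq> a} = insert a B"
    using BD a(3,4) step.prems(3) by (auto simp: B_def)
  then show ?case
    using out1 out2 a BD by (auto simp: B_def)
qed

section \<open>Interior points and invariance of domain\<close>

text \<open>Points of \<open>Euclidean_space k\<close> are sequences vanishing from index
  \<open>k\<close> on. If \<open>d < k\<close>, coordinate \<open>d\<close> may be varied inside
  \<open>Euclidean_space k\<close>, but only the value 0 stays in \<open>Euclidean_space d\<close>;
  the preimage of \<open>U\<close> on this line would be the open set {0}.\<close>

lemma openin_Euclidean_space_subset_imp_le:
  assumes "openin (Euclidean_space k) U" and "U \<noteq> {}" and "U \<subseteq> topspace (Euclidean_space d)"
  shows "k \<le> d"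
proof (rule ccontr)
  assume "\<not> k \<le> d"
  then have "d < k" by simp
  obtain x where x: "x \<in> U" using assms(2) by blast
  then have xk: "x \<in> topspace (Euclidean_space k)"
    using assms(1) openin_subset by blast
  define f :: "real \<Rightarrow> nat \<Rightarrow> real" where "f t = x(d := t)" for t
  have "continuous_map euclideanreal (powertop_real UNIV) f"
    unfolding continuous_map_componentwise_UNIV f_def by simp
  moreover have "f t \<in> topspace (Euclidean_space k)" for t
    using xk \<open>d < k\<close> by (auto simp: f_def topspace_Euclidean_space)
  ultimately have "continuous_map euclideanreal (Euclidean_space k) f"
    by (auto simp: Euclidean_space_def continuous_map_in_subtopology topspace_Euclidean_space)
  then have "openin euclideanreal {t \<in> topspace euclideanreal. f t \<in> U}"
    using assms(1) openin_continuous_map_preimage by blast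
  then have "open {t. f t \<in> U}" by simp
  moreover have "{t. f t \<in> U} = {0}"
  proof -
    have "x d = 0" using x assms(3) by (auto simp: topspace_Euclidean_space)
    then have "f 0 = x" by (auto simp: f_def)
    moreover have "t = 0" if "f t \<in> U" for t
    proof -
      have "f t d = 0" using that assms(3) by (auto simp: topspace_Euclidean_space)
      then show ?thesis by (simp add: f_def)
    qed
    ultimately show ?thesis using x by auto
  qed
  ultimately show False using not_open_singleton[of "0::real"] by simp
qed

text \<open>If \<open>d < k\<close>, then \<open>f\<close> is also a map into the larger
  \<open>Euclidean_space k\<close>. Invariance of domain makes its image open there, although it
  lies in \<open>Euclidean_space d\<close>.\<close>

lemma invariance_of_dimension_Euclidean_space_le:
  assumes U: "openin (Euclidean_space k) U" "U \<noteq> {}"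
    and f: "continuous_map (subtopology (Euclidean_space k) U) (Euclidean_space d) f" "inj_on f U"
  shows "k \<le> d"
proof (rule ccontr)
  assume "\<not> k \<le> d"
  then have "Euclidean_space d = subtopology (Euclidean_space k) (topspace (Euclidean_space d))"
    by (metis Euclidean_space_def inf.absorb_iff2 nle_le subset_Euclidean_space
        subtopology_subtopology topspace_Euclidean_space)
  then have cf: "continuous_map (subtopology (Euclidean_space k) U) (Euclidean_space k) f"
    using f(1) by (metis continuous_map_in_subtopology)
  have "openin (Euclidean_space k) (f ` U)"
    using invariance_of_domain_Euclidean_space U(1) cf f(2) by blast
  moreover have "f ` U \<subseteq> topspace (Euclidean_space d)"
    using continuous_map_image_subset_topspace[OF f(1)] openin_subset[OF U(1)]
    by (metis topspace_subtopology_subset)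
  ultimately have "k \<le> d"
    using openin_Euclidean_space_subset_imp_le U(2) by blast
  then show False using \<open>\<not> k \<le> d\<close> by simp
qed

text \<open>Invariance of domain is used in both directions. An open piece of the affine hull embeds
  in \<open>Euclidean_space d\<close>, so \<open>k \<le> d\<close>; then \<open>V\<close> embeds in
  the affine hull with image \<open>W\<close>, so \<open>W\<close> is open there and consists of
  relative interior points.\<close>

lemma locally_Euclidean_point_in_rel_interior:
  fixes S :: "'b::euclidean_space set"
  assumes S: "convex S" and W: "openin (top_of_set S) W" and p: "p \<in> W"
    and V: "openin (Euclidean_space d) V"
    and hom: "top_of_set W homeomorphic_space subtopology (Euclidean_space d) V"
  shows "p \<in> rel_interior S"
proof -
  obtain T where T: "open T" "W = S \<inter> T" using W openin_open by blast
  have "S \<noteq> {}" using p T by auto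
  define A where "A = affine hull S"
  define k where "k = nat (aff_dim S)"
  \<comment> \<open>Since \<open>S\<close> is nonempty its dimension is not -1, so
    \<open>nat\<close> loses nothing.\<close>
  have "aff_dim A = int k"
    using \<open>S \<noteq> {}\<close> aff_dim_geq[of S] aff_dim_empty[of S] by (simp add: A_def k_def)
  then have "top_of_set A homeomorphic_space Euclidean_space k"
    using homeomorphic_affine_Euclidean_space[of A] by (simp add: A_def affine_affine_hull)
  then obtain g g' where g: "homeomorphic_maps (top_of_set A) (Euclidean_space k) g g'"
    unfolding homeomorphic_space_def by blast
  obtain h h' where h: "homeomorphic_maps (top_of_set W) (subtopology (Euclidean_space d) V) h h'"
    using hom unfolding homeomorphic_space_def by blast
  have WA: "W \<subseteq> A" using T hull_subset[of S affine] by (auto simp: A_def)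
  have openA: "openin (Euclidean_space k) (g ` Q) \<longleftrightarrow> openin (top_of_set A) Q" if "Q \<subseteq> A" for Q
    using homeomorphic_map_openness[of "top_of_set A" "Euclidean_space k" g Q] g that
      homeomorphic_maps_imp_map by fastforce
  have gQ: "homeomorphic_maps (top_of_set Q) (subtopology (Euclidean_space k) (g ` Q)) g g'"
    if "Q \<subseteq> A" for Q
  proof -
    have "g ` (topspace (top_of_set A) \<inter> Q) = topspace (Euclidean_space k) \<inter> g ` Q"
      using g that by (auto simp: homeomorphic_maps_def continuous_map_def)
    from homeomorphic_maps_subtopologies[OF g this] that show ?thesis
      by (simp add: subtopology_subtopology inf.absorb2)
  qed
  have hV: "homeomorphic_maps (subtopology (Euclidean_space d) V) (top_of_set W) h' h"
    using h homeomorphic_maps_sym by blast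
  have Vtop: "topspace (subtopology (Euclidean_space d) V) = V"
    by (rule topspace_subtopology_subset[OF openin_subset[OF V]])
  \<comment> \<open>Whether \<open>p\<close> is relatively interior is still open, so the dimension
    is compared on nearby relative interior points. They exist because \<open>p\<close> lies in the
    closure of the relative interior.\<close>
  define R where "R = T \<inter> rel_interior S"
  have RW: "R \<subseteq> W" using rel_interior_subset T by (auto simp: R_def)
  have "R \<noteq> {}"
  proof -
    have "p \<in> closure (rel_interior S)"
      using p T convex_closure_rel_interior[OF S] closure_subset[of S] by auto
    then show ?thesis
      using T p open_Int_closure_eq_empty[of T "rel_interior S"] by (auto simp: R_def)
  qed
  have oR: "openin (top_of_set A) R"
    unfolding R_def A_def Int_commute[of T] by (rule openin_Int_open[OF openin_rel_interior T(1)])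
  have "k \<le> d"
  proof (rule invariance_of_dimension_Euclidean_space_le)
    show "openin (Euclidean_space k) (g ` R)" using openA oR RW WA by blast
    show "g ` R \<noteq> {}" using \<open>R \<noteq> {}\<close> by blast
    have gR: "homeomorphic_maps (top_of_set R) (subtopology (Euclidean_space k) (g ` R)) g g'"
      using gQ RW WA by blast
    then have c1: "continuous_map (subtopology (Euclidean_space k) (g ` R)) (top_of_set R) g'"
      by (simp add: homeomorphic_maps_def)
    have "continuous_map (top_of_set W) (Euclidean_space d) h"
      using h by (simp add: homeomorphic_maps_def continuous_map_in_subtopology)
    then have "continuous_map (top_of_set R) (Euclidean_space d) h"
      using RW by (rule continuous_map_from_subtopology_mono)
    with c1 show "continuous_map (subtopology (Euclidean_space k) (g ` R)) (Euclidean_space d) (h \<circ> g')"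
      by (rule continuous_map_compose)
    have "g' (g x) = x" if "x \<in> R" for x
      using gR that by (simp add: homeomorphic_maps_def)
    moreover have "inj_on h R"
      using h RW by (auto simp: homeomorphic_maps_def intro: inj_on_inverseI)
    ultimately show "inj_on (h \<circ> g') (g ` R)"
      by (auto simp: inj_on_def)
  qed
  have "openin (Euclidean_space k) ((g \<circ> h') ` V)"
  proof (rule invariance_of_domain_Euclidean_space_gen[OF \<open>k \<le> d\<close> V])
    have gW: "homeomorphic_maps (top_of_set W) (subtopology (Euclidean_space k) (g ` W)) g g'"
      using gQ WA by blast
    then have "continuous_map (top_of_set W) (Euclidean_space k) g"
      by (simp add: homeomorphic_maps_def continuous_map_in_subtopology)
    moreover have "continuous_map (subtopology (Euclidean_space d) V) (top_of_set W) h'"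
      using hV by (simp add: homeomorphic_maps_def)
    ultimately show "continuous_map (subtopology (Euclidean_space d) V) (Euclidean_space k) (g \<circ> h')"
      by (metis continuous_map_compose)
    have "h' ` V \<subseteq> W"
      using hV Vtop by (auto simp: homeomorphic_maps_def continuous_map_def)
    moreover have "inj_on h' V"
      using hV Vtop by (metis homeomorphic_maps_def inj_on_inverseI)
    moreover have "inj_on g W"
      using gW by (metis homeomorphic_maps_def inj_on_inverseI topspace_euclidean_subtopology)
    ultimately show "inj_on (g \<circ> h') V"
      by (meson comp_inj_on inj_on_subset)
  qed
  moreover have "h' ` V = W"
    using hV Vtop homeomorphic_imp_surjective_map homeomorphic_maps_imp_map
    by (metis topspace_euclidean_subtopology)
  ultimately have "openin (Euclidean_space k) (g ` W)"
    by (metis image_comp)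
  then have "openin (top_of_set A) W" using openA WA by blast
  then show ?thesis
    using p T rel_interior_maximal[of W S] by (auto simp: A_def)
qed

section \<open>Branching of polytopal subdivisions\<close>

text \<open>By Krein-Milman. With \<open>T\<close> empty or a singleton it produces a vertex, or a
  second vertex; with \<open>T\<close> a face it shows that a face containing all vertices is the
  whole polytope.\<close>

lemma polytope_extreme_points_subset:
  fixes S :: "'b::euclidean_space set"
  assumes "polytope S" "convex T" "\<And>u. u extreme_point_of S \<Longrightarrow> u \<in> T"
  shows "S \<subseteq> T"
proof -
  have "S = convex hull {u. u extreme_point_of S}"
    by (rule Krein_Milman_Minkowski[OF polytope_imp_compact[OF assms(1)] polytope_imp_convex[OF assms(1)]])
  also have "\<dots> \<subseteq> T"
    using assms(2,3) by (intro hull_minimal) auto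
  finally show ?thesis .
qed

text \<open>A nonempty \<open>F\<close> is the intersection of the facets containing it, so one of
  them does not contain \<open>A\<close>. For empty \<open>F\<close> a vertex serves: one of
  \<open>A\<close>, or a different one of \<open>S\<close> if \<open>A\<close> is itself a
  vertex.\<close>

lemma polytope_faces_branched:
  fixes S :: "'b::euclidean_space set"
  assumes S: "polytope S" and A: "A face_of S" and F: "F face_of S"
    and FA: "F \<subset> A" and AS: "A \<subset> S"
  shows "\<exists>G. G face_of S \<and> G \<noteq> A \<and> F \<subset> G \<and> G \<subset> S"
proof (cases "F = {}")
  case True
  obtain v where v: "v extreme_point_of A"
    using polytope_extreme_points_subset[OF face_of_polytope_polytope[OF S A], of "{}"] FA by auto
  have vS: "{v} face_of S"
    using v A extreme_point_of_face face_of_singleton by blast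
  show ?thesis
  proof (cases "A = {v}")
    case False
    have "v \<in> A" using v by (simp add: extreme_point_of_def)
    then show ?thesis using vS False True AS by (intro exI[of _ "{v}"]) auto
  next
    case A: True
    then obtain u where u: "u extreme_point_of S" "u \<noteq> v"
      using polytope_extreme_points_subset[OF S, of "{v}"] AS by auto
    then have "u \<in> S" by (simp add: extreme_point_of_def)
    then show ?thesis
      using u A True AS face_of_singleton[of u S] by (intro exI[of _ "{u}"]) auto
  qed
next
  case False
  have ph: "polyhedron S" and cS: "convex S" and cA: "convex A"
    using S A polytope_imp_polyhedron polytope_imp_convex face_of_imp_convex by blast+
  have "F = \<Inter>{G. G facet_of S \<and> F \<subseteq> G}"
    using face_of_polyhedron[OF ph F False] FA AS by blast
  then obtain G where G: "G facet_of S" "F \<subseteq> G" "\<not> A \<subseteq> G"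
    using FA by blast
  have "F face_of A" using face_of_face[OF A, of F] F FA by blast
  \<comment> \<open>The dimension of \<open>F\<close> is at least two below that of
    \<open>S\<close>, so the facet \<open>G\<close> is strictly larger than
    \<open>F\<close>.\<close>
  then have "aff_dim F < aff_dim A" using face_of_aff_dim_lt[OF cA] FA by blast
  moreover have "aff_dim A < aff_dim S" using face_of_aff_dim_lt[OF cS A] AS by blast
  moreover have "aff_dim G = aff_dim S - 1" using G(1) by (simp add: facet_of_def)
  ultimately have "G \<noteq> F" "G \<noteq> S" by auto
  then show ?thesis
    using G facet_of_imp_face_of[OF G(1)] facet_of_imp_subset[OF G(1)] by (intro exI[of _ G]) auto
qed

section \<open>Cells of a subdivision and their faces\<close>

locale subdivided_space =
  fixes X :: "'a topology" and P :: "'a set set"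
    and K :: "'a set \<Rightarrow> 'b::euclidean_space set" and \<phi> :: "'a set \<Rightarrow> 'b \<Rightarrow> 'a"
  assumes subdivision: "polytopal_subdivision X P K \<phi>"
begin

lemma
  shows Union_cells: "\<Union>P = topspace X"
    and empty_cell: "{} \<in> P"
    and polytope_cell: "c \<in> P \<Longrightarrow> polytope (K c)"
    and homeomorphic_cell: "c \<in> P \<Longrightarrow> homeomorphic_map (top_of_set (K c)) (subtopology X c) (\<phi> c)"
    and cell_faces_subset: "c \<in> P \<Longrightarrow> cell_faces K \<phi> c \<subseteq> P"
    and Int_cell_faces: "c \<in> P \<Longrightarrow> c' \<in> P \<Longrightarrow> c \<inter> c' \<in> cell_faces K \<phi> c"
  using subdivision by (simp_all add: polytopal_subdivision_def)

lemma face_in_cells: "c \<in> P \<Longrightarrow> F face_of K c \<Longrightarrow> \<phi> c ` F \<in> P"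
  using cell_faces_subset unfolding cell_faces_def by blast

lemma cell_subset: "c \<in> P \<Longrightarrow> c \<subseteq> topspace X"
  using Union_cells by blast

lemma cell_image: "c \<in> P \<Longrightarrow> \<phi> c ` K c = c"
  using homeomorphic_imp_surjective_map[OF homeomorphic_cell] cell_subset
  by (metis topspace_euclidean_subtopology topspace_subtopology_subset)

lemma cell_inj: "c \<in> P \<Longrightarrow> inj_on (\<phi> c) (K c)"
  using homeomorphic_imp_injective_map[OF homeomorphic_cell] by fastforce

lemma Int_cell: "c \<in> P \<Longrightarrow> c' \<in> P \<Longrightarrow> c \<inter> c' \<in> P"
  using Int_cell_faces cell_faces_subset by blast

lemma subcell_face:
  assumes "c \<in> P" "c' \<in> P" "c' \<subseteq> c"
  obtains F where "F face_of K c" "c' = \<phi> c ` F"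
  using Int_cell_faces[OF assms(1,2)] assms(3) unfolding cell_faces_def by (auto simp: Int_absorb1)

lemma face_image_mono:
  assumes "c \<in> P" "F face_of K c" "G face_of K c"
  shows "\<phi> c ` F \<subseteq> \<phi> c ` G \<longleftrightarrow> F \<subseteq> G"
  by (rule inj_on_image_subset_iff[OF cell_inj[OF assms(1)] face_of_imp_subset[OF assms(2)]
        face_of_imp_subset[OF assms(3)]])

lemma extreme_point_vertex:
  assumes "c \<in> P" "u extreme_point_of K c"
  shows "\<phi> c u \<in> c \<inter> vertices P"
proof -
  have "\<phi> c ` {u} \<in> P"
    using assms face_of_singleton[of u "K c"] face_in_cells by blast
  moreover have "u \<in> K c" using assms(2) by (simp add: extreme_point_of_def)
  ultimately show ?thesis
    using cell_image[OF assms(1)] by (auto simp: vertices_def)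
qed

text \<open>The intersection \<open>c \<inter> c'\<close> is the image of a face of
  \<open>K c\<close> containing every extreme point, hence of \<open>K c\<close> itself. This is why
  cells can be identified with their vertex sets.\<close>

lemma cell_subset_if_vertices_subset:
  assumes c: "c \<in> P" and c': "c' \<in> P" and V: "c \<inter> vertices P \<subseteq> c'"
  shows "c \<subseteq> c'"
proof -
  obtain F where F: "F face_of K c" "c \<inter> c' = \<phi> c ` F"
    using Int_cell_faces[OF c c'] unfolding cell_faces_def by blast
  have "K c \<subseteq> F"
  proof (rule polytope_extreme_points_subset)
    show "polytope (K c)" using c by (rule polytope_cell)
    show "convex F" using F(1) by (rule face_of_imp_convex)
    fix u assume u: "u extreme_point_of K c"
    then have "\<phi> c u \<in> \<phi> c ` F" using extreme_point_vertex[OF c u] V F(2) by blast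
    moreover have "u \<in> K c" using u by (simp add: extreme_point_of_def)
    ultimately show "u \<in> F"
      using inj_on_image_mem_iff[OF cell_inj[OF c]] face_of_imp_subset[OF F(1)] by blast
  qed
  then show ?thesis using F(2) cell_image[OF c] by blast
qed

text \<open>The injective map \<open>\<phi> z\<close> is an order isomorphism from the faces of
  \<open>K z\<close> onto the cells inside \<open>z\<close>, so branching carries over from the
  polytope.\<close>

lemma cells_branched:
  assumes P: "z \<in> P" "a \<in> P" "x \<in> P" and "x \<subset> a" "a \<subset> z"
  shows "\<exists>w\<in>P. w \<noteq> a \<and> x \<subset> w \<and> w \<subset> z"
proof -
  obtain A where A: "A face_of K z" "a = \<phi> z ` A"
    by (rule subcell_face[OF P(1,2) psubset_imp_subset[OF assms(5)]])
  obtain F where F: "F face_of K z" "x = \<phi> z ` F"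
    by (rule subcell_face[OF P(1,3) psubset_imp_subset[OF psubset_trans[OF assms(4,5)]]])
  have iff: "\<phi> z ` G \<subset> \<phi> z ` H \<longleftrightarrow> G \<subset> H" if "G face_of K z" "H face_of K z" for G H
    using face_image_mono[OF P(1)] that by (auto simp: less_le_not_le)
  have Z: "K z face_of K z"
    using polytope_imp_convex[OF polytope_cell[OF P(1)]] by (rule face_of_refl)
  have "F \<subset> A" using assms(4) iff[OF F(1) A(1)] A(2) F(2) by simp
  moreover have "A \<subset> K z" using assms(5) iff[OF A(1) Z] A(2) cell_image[OF P(1)] by simp
  ultimately obtain G where G: "G face_of K z" "G \<noteq> A" "F \<subset> G" "G \<subset> K z"
    using polytope_faces_branched[OF polytope_cell[OF P(1)] A(1) F(1)] by metis
  have "\<phi> z ` G \<in> P" using face_in_cells P(1) G(1) by blast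
  moreover have "\<phi> z ` G \<noteq> a"
    using G(2) face_image_mono[OF P(1) G(1) A(1)] face_image_mono[OF P(1) A(1) G(1)] A(2)
    by (metis subset_antisym subset_refl)
  moreover have "x \<subset> \<phi> z ` G" using iff[OF F(1) G(1)] G(3) F(2) by simp
  moreover have "\<phi> z ` G \<subset> z" using iff[OF G(1) Z] G(4) cell_image[OF P(1)] by simp
  ultimately show ?thesis by (intro bexI[of _ "\<phi> z ` G"] conjI)
qed

section \<open>Facets and the absence of boundary\<close>

lemma closedin_cell:
  assumes "Hausdorff_space X" "c \<in> P"
  shows "closedin X c"
proof -
  have "compact_space (top_of_set (K c))"
    using polytope_imp_compact[OF polytope_cell[OF assms(2)]] by (simp add: compact_space_subtopology)
  then have "compact_space (subtopology X c)"
    using homeomorphic_compact_space homeomorphic_map_imp_homeomorphic_space[OF homeomorphic_cell[OF assms(2)]]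
    by blast
  then have "compactin X c"
    using cell_subset[OF assms(2)] by (simp add: compactin_subspace)
  then show ?thesis using assms(1) compactin_imp_closedin by blast
qed

lemma cell_in_facet:
  assumes "finite P" "c \<in> P"
  obtains b where "b \<in> facets P" "c \<subseteq> b"
proof -
  obtain b where "b \<in> P" "c \<subseteq> b" "\<forall>c'\<in>P. b \<subseteq> c' \<longrightarrow> b = c'"
    using finite_has_maximal2[OF assms] by blast
  then show ?thesis using that by (simp add: facets_def) metis
qed

text \<open>A relative interior point of a face of \<open>a\<close> lying in no other facet has a neighbourhood
  inside \<open>a\<close>, and invariance of domain would make it an interior point of \<open>a\<close>.\<close>

lemma facets_branched:
  assumes man: "closed_manifold d X" and fin: "finite P"
    and a: "a \<in> facets P" and x: "x \<in> P" "x \<subset> a" "x \<noteq> {}"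
  shows "\<exists>b\<in>facets P. b \<noteq> a \<and> x \<subseteq> b"
proof (rule ccontr)
  assume none: "\<not> ?thesis"
  have aP: "a \<in> P" using a by (simp add: facets_def)
  define S where "S = K a"
  have S: "convex S" using polytope_imp_convex[OF polytope_cell[OF aP]] by (simp add: S_def)
  have inj: "inj_on (\<phi> a) S" and im: "\<phi> a ` S = a"
    using cell_inj cell_image aP by (auto simp: S_def)
  obtain F where F: "F face_of S" "x = \<phi> a ` F"
    using subcell_face[OF aP x(1)] x(2) unfolding S_def by blast
  have FS: "F \<subseteq> S" "F \<noteq> S" "F \<noteq> {}"
    using face_of_imp_subset[OF F(1)] F(2) x(2,3) im by auto
  \<comment> \<open>A face of \<open>S\<close> containing the relative interior point
    \<open>p\<close> of \<open>F\<close> contains all of \<open>F\<close>.\<close>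
  obtain p where p: "p \<in> rel_interior F"
    using FS(3) rel_interior_eq_empty[OF face_of_imp_convex[OF F(1)]] by blast
  have pF: "p \<in> F" using p rel_interior_subset by blast
  define q where "q = \<phi> a p"
  have qa: "q \<in> a" "q \<in> x" using pF FS im F(2) by (auto simp: q_def)
  \<comment> \<open>A cell through \<open>q\<close> contains \<open>x\<close>, hence so does any
    facet above that cell; by assumption this facet is \<open>a\<close>.\<close>
  have in_a: "c \<subseteq> a" if c: "c \<in> P" "q \<in> c" for c
  proof -
    have "c \<inter> x \<in> P" "c \<inter> x \<subseteq> a" using Int_cell c x by auto
    then obtain G where G: "G face_of S" "c \<inter> x = \<phi> a ` G"
      using subcell_face[OF aP] unfolding S_def by blast
    have "q \<in> \<phi> a ` G" using G(2) c(2) qa by blast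
    then have "p \<in> G"
      using inj_on_image_mem_iff[OF inj] face_of_imp_subset[OF G(1)] pF FS(1) unfolding q_def by blast
    then have "F \<subseteq> G" using subset_of_face_of[OF G(1) FS(1)] p by blast
    then have "x \<subseteq> c" using G(2) F(2) by blast
    obtain b where "b \<in> facets P" "c \<subseteq> b" using cell_in_facet[OF fin c(1)] by blast
    then show ?thesis using none \<open>x \<subseteq> c\<close> by blast
  qed
  have Haus: "Hausdorff_space X" and LE: "locally_Euclidean_space d X"
    using man by (auto simp: closed_manifold_def)
  \<comment> \<open>Removing the finitely many closed cells that miss \<open>q\<close> leaves an
    open neighbourhood of \<open>q\<close>, covered by cells through \<open>q\<close> and so
    contained in \<open>a\<close>.\<close>
  define U0 where "U0 = topspace X - \<Union>{c \<in> P. q \<notin> c}"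
  have "openin X U0"
    unfolding U0_def using fin closedin_cell[OF Haus]
    by (intro openin_diff openin_topspace closedin_Union) auto
  have qX: "q \<in> topspace X" using qa(1) cell_subset[OF aP] by blast
  have "U0 \<subseteq> a"
  proof
    fix y assume y: "y \<in> U0"
    then obtain c where "c \<in> P" "y \<in> c" using Union_cells by (auto simp: U0_def)
    then show "y \<in> a" using y in_a by (auto simp: U0_def)
  qed
  have "q \<in> U0" using qX by (auto simp: U0_def)
  obtain U V where U: "openin X U" "q \<in> U" "openin (Euclidean_space d) V"
    "subtopology X U homeomorphic_space subtopology (Euclidean_space d) V"
    using LE qX unfolding locally_Euclidean_space_def by blast
  obtain e where e: "homeomorphic_map (subtopology X U) (subtopology (Euclidean_space d) V) e"
    using U(4) homeomorphic_space by blast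
  define U1 where "U1 = U \<inter> U0"
  have U1: "openin X U1" "U1 \<subseteq> a" "q \<in> U1" "U1 \<subseteq> U"
    using \<open>openin X U0\<close> U \<open>U0 \<subseteq> a\<close> \<open>q \<in> U0\<close> by (auto simp: U1_def)
  have U1X: "U1 \<subseteq> topspace X" using U1(1) openin_subset by blast
  have topU: "topspace (subtopology X U) = U"
    using U(1) openin_subset topspace_subtopology_subset by metis
  have eU1: "openin (subtopology (Euclidean_space d) V) (e ` U1)"
    using homeomorphic_map_openness[OF e, of U1] U1 U1X topU openin_open_subtopology[OF U(1)] by simp
  then have oe: "openin (Euclidean_space d) (e ` U1)"
    using openin_open_subtopology[OF U(3)] by blast
  have "homeomorphic_map (subtopology (subtopology X U) U1)
      (subtopology (subtopology (Euclidean_space d) V) (e ` U1)) e"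
  proof (rule homeomorphic_map_subtopologies[OF e])
    show "e ` (topspace (subtopology X U) \<inter> U1) = topspace (subtopology (Euclidean_space d) V) \<inter> e ` U1"
      using openin_subset[OF eU1] topU U1(4) by (simp add: Int_absorb1 Int_absorb2)
  qed
  moreover have "U \<inter> U1 = U1" "V \<inter> e ` U1 = e ` U1"
    using U1(4) openin_subset[OF eU1] by auto
  ultimately have homU: "subtopology X U1 homeomorphic_space subtopology (Euclidean_space d) (e ` U1)"
    by (metis homeomorphic_map_imp_homeomorphic_space subtopology_subtopology)
  \<comment> \<open>Pulled back along \<open>\<phi> a\<close>, the neighbourhood \<open>U1\<close>
    becomes a relatively open subset of the polytope around \<open>p\<close> that is homeomorphic to
    an open subset of \<open>Euclidean_space d\<close>.\<close>
  define W where "W = {s \<in> S. \<phi> a s \<in> U1}"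
  have hom: "homeomorphic_map (top_of_set S) (subtopology X a) (\<phi> a)"
    unfolding S_def by (rule homeomorphic_cell[OF aP])
  have imW: "\<phi> a ` W = U1" using im U1(2) by (auto simp: W_def)
  have "openin (subtopology X a) U1" using U1 by (metis inf.absorb_iff1 openin_subtopology)
  then have oW: "openin (top_of_set S) W"
    using homeomorphic_map_openness[OF hom, of W] imW by (auto simp: W_def)
  have "homeomorphic_map (subtopology (top_of_set S) W) (subtopology (subtopology X a) U1) (\<phi> a)"
  proof (rule homeomorphic_map_subtopologies[OF hom])
    show "\<phi> a ` (topspace (top_of_set S) \<inter> W) = topspace (subtopology X a) \<inter> U1"
      using imW U1(2) U1X by (auto simp: W_def)
  qed
  moreover have "S \<inter> W = W" "a \<inter> U1 = U1" using U1(2) by (auto simp: W_def)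
  ultimately have "top_of_set W homeomorphic_space subtopology X U1"
    by (metis homeomorphic_map_imp_homeomorphic_space subtopology_subtopology)
  then have "top_of_set W homeomorphic_space subtopology (Euclidean_space d) (e ` U1)"
    using homU homeomorphic_space_trans by blast
  moreover have "p \<in> W" using pF FS U1(3) by (auto simp: W_def q_def)
  ultimately have "p \<in> rel_interior S"
    using locally_Euclidean_point_in_rel_interior[OF S oW _ oe] by blast
  \<comment> \<open>A proper face is disjoint from the relative interior.\<close>
  then show False
    using face_of_disjoint_rel_interior[OF F(1) FS(2)] pF by blast
qed

section \<open>From cells to labelled vertex sets\<close>

lemma vertex_set_subset_iff:
  assumes "inj_on lab (vertices P)" "c \<in> P" "c' \<in> P"
  shows "vertex_set lab P c \<subseteq> vertex_set lab P c' \<longleftrightarrow> c \<subseteq> c'"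
proof -
  have "vertex_set lab P c \<subseteq> vertex_set lab P c' \<longleftrightarrow> c \<inter> vertices P \<subseteq> c' \<inter> vertices P"
    unfolding vertex_set_def using assms(1) by (intro inj_on_image_subset_iff) auto
  also have "\<dots> \<longleftrightarrow> c \<subseteq> c'"
    using cell_subset_if_vertices_subset[OF assms(2,3)] by blast
  finally show ?thesis .
qed

lemma vertex_set_inj: "inj_on lab (vertices P) \<Longrightarrow> inj_on (vertex_set lab P) P"
  using vertex_set_subset_iff by (intro inj_onI equalityI) blast+

lemma vertex_set_Int:
  assumes "inj_on lab (vertices P)"
  shows "vertex_set lab P c \<inter> vertex_set lab P c' = vertex_set lab P (c \<inter> c')"
proof -
  have "lab ` (c \<inter> vertices P) \<inter> lab ` (c' \<inter> vertices P) = lab ` ((c \<inter> vertices P) \<inter> (c' \<inter> vertices P))"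
    using inj_on_image_Int[OF assms] by (metis inf_le2)
  then show ?thesis by (simp add: vertex_set_def Int_ac)
qed

lemma nonempty_cell_vertex:
  assumes "c \<in> P" "c \<noteq> {}"
  obtains v where "v \<in> c" "v \<in> vertices P"
  using cell_subset_if_vertices_subset[OF assms(1) empty_cell] assms(2) by blast

text \<open>Three cases: above the empty face a vertex other than \<open>a\<close> is needed, which
  exists because there is not exactly one vertex; if \<open>a\<close> is not a facet, a strictly
  larger cell serves; for a facet and nonempty \<open>x\<close> the manifold has no boundary at
  \<open>x\<close>.\<close>

lemma cells_branched_top:
  assumes man: "closed_manifold d X" and fin: "finite P"
    and "card (vertices P) \<noteq> 1" and a: "a \<in> P" and x: "x \<in> P" "x \<subset> a"
  shows "\<exists>w\<in>P. w \<noteq> a \<and> x \<subset> w"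
proof (cases "x = {}")
  case True
  then obtain v where v: "v \<in> a" "v \<in> vertices P"
    using nonempty_cell_vertex[OF a] x(2) by blast
  obtain u where u: "u \<in> vertices P" "a \<noteq> {u}"
  proof (cases "a = {v}")
    case True
    have "vertices P \<noteq> {v}" using assms(3) by auto
    then show ?thesis using that v(2) True by blast
  next
    case False
    then show ?thesis using that v(2) by blast
  qed
  then show ?thesis using True by (intro bexI[of _ "{u}"]) (auto simp: vertices_def)
next
  case False
  show ?thesis
  proof (cases "a \<in> facets P")
    case True
    then obtain b where b: "b \<in> facets P" "b \<noteq> a" "x \<subseteq> b"
      using facets_branched[OF man fin True x False] by blast
    then have "x \<noteq> b" using x(2) a by (auto simp: facets_def)
    then show ?thesis using b by (auto simp: facets_def)
  next
    case False
    then show ?thesis using a x(2) by (auto simp: facets_def)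
  qed
qed

lemma maximal_in_vertex_sets:
  assumes "inj_on lab (vertices P)"
  shows "{A. maximal_in (vertex_set lab P ` P) A} = vertex_set lab P ` facets P"
proof (intro equalityI subsetI)
  fix A assume "A \<in> {A. maximal_in (vertex_set lab P ` P) A}"
  then obtain c where c: "c \<in> P" "A = vertex_set lab P c"
    "\<And>c'. c' \<in> P \<Longrightarrow> A \<subseteq> vertex_set lab P c' \<Longrightarrow> vertex_set lab P c' = A"
    unfolding maximal_in_def by blast
  have "c' = c" if "c' \<in> P" "c \<subseteq> c'" for c'
    using c that vertex_set_subset_iff[OF assms] by (metis subset_antisym subset_refl)
  then show "A \<in> vertex_set lab P ` facets P" using c(1,2) by (auto simp: facets_def)
next
  fix A assume "A \<in> vertex_set lab P ` facets P"
  then show "A \<in> {A. maximal_in (vertex_set lab P ` P) A}"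
    using vertex_set_subset_iff[OF assms] by (fastforce simp: facets_def maximal_in_def)
qed

lemma locally_branched_vertex_sets:
  assumes inj: "inj_on lab (vertices P)" and "Q \<subseteq> P"
    and br: "\<And>a x. a \<in> Q \<Longrightarrow> x \<in> Q \<Longrightarrow> x \<subset> a \<Longrightarrow> \<exists>w\<in>Q. w \<noteq> a \<and> x \<subset> w"
  shows "locally_branched_below (vertex_set lab P ` Q)"
proof -
  have iff: "vertex_set lab P c \<subset> vertex_set lab P c' \<longleftrightarrow> c \<subset> c'" if "c \<in> Q" "c' \<in> Q" for c c'
    using vertex_set_subset_iff[OF inj] that assms(2) by (metis less_le_not_le subsetD)
  show ?thesis
    unfolding locally_branched_below_def
  proof (intro ballI impI)
    fix A B assume "A \<in> vertex_set lab P ` Q" "B \<in> vertex_set lab P ` Q" "B \<subset> A"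
    then obtain a x where ax: "a \<in> Q" "x \<in> Q" "A = vertex_set lab P a" "B = vertex_set lab P x"
      by blast
    then have "x \<subset> a" using iff \<open>B \<subset> A\<close> by blast
    then obtain w where w: "w \<in> Q" "w \<noteq> a" "x \<subset> w" using br[OF ax(1,2)] by blast
    then have "vertex_set lab P w \<noteq> A"
      using ax inj_onD[OF vertex_set_inj[OF inj]] assms(2) by blast
    then show "\<exists>W\<in>vertex_set lab P ` Q. W \<noteq> A \<and> B \<subset> W"
      using w ax iff by (intro bexI[of _ "vertex_set lab P w"]) auto
  qed
qed

section \<open>The algorithm on the vertex sets of cells\<close>

lemma face_iterator_visits_cells:
  assumes man: "closed_manifold d X" and fin: "finite P" and inj: "inj_on lab (vertices P)"
    and "card (vertices P) \<noteq> 1"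
    and C: "distinct C" "set C = vertex_set lab P ` facets P"
    and run: "face_iterator C [] {} out"
  shows "distinct out \<and> set out = vertex_set lab P ` P"
proof -
  let ?V = "vertex_set lab P"
  have "distinct out \<and> set out = {A \<in> ?V ` P. \<forall>y\<in>set []. \<not> A \<subseteq> y}"
  proof (rule face_iterator_visits[OF run refl C(1), where L = "?V ` P"])
    show "finite (?V ` P)" using fin by simp
    show "A \<inter> B \<in> ?V ` P" if "A \<in> ?V ` P" "B \<in> ?V ` P" for A B
      using that vertex_set_Int[OF inj] Int_cell by auto
    show "locally_branched_below {A \<in> ?V ` P. A \<subset> Z}" if Z: "Z \<in> ?V ` P" for Z
    proof -
      obtain z where z: "z \<in> P" "Z = ?V z" using Z by blast
      have "?V c \<subset> Z \<longleftrightarrow> c \<subset> z" if "c \<in> P" for c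
        using vertex_set_subset_iff[OF inj] that z by (simp add: less_le_not_le)
      then have "{A \<in> ?V ` P. A \<subset> Z} = ?V ` {c \<in> P. c \<subset> z}"
        by blast
      moreover have "locally_branched_below (?V ` {c \<in> P. c \<subset> z})"
      proof (rule locally_branched_vertex_sets[OF inj])
        fix a x assume "a \<in> {c \<in> P. c \<subset> z}" "x \<in> {c \<in> P. c \<subset> z}" "x \<subset> a"
        then show "\<exists>w\<in>{c \<in> P. c \<subset> z}. w \<noteq> a \<and> x \<subset> w"
          using cells_branched[OF z(1), of a x] by simp blast
      qed simp
      ultimately show ?thesis by simp
    qed
    show "locally_branched_below (?V ` P)"
      using cells_branched_top[OF man fin assms(4)] by (intro locally_branched_vertex_sets[OF inj]) auto
    show "set C = {A. maximal_in (?V ` P) A \<and> (\<forall>y\<in>set []. \<not> A \<subseteq> y)}"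
      using C(2) maximal_in_vertex_sets[OF inj] by simp
  qed auto
  then show ?thesis by simp
qed

text \<open>The exceptional one-point case: with no second coatom to intersect with,
  \<open>N1\<close> is empty, so the empty face is never reached.\<close>

lemma face_iterator_single_vertex:
  assumes V: "vertices P = {v}"
    and C: "distinct C" "set C = vertex_set lab P ` facets P"
    and run: "face_iterator C [] {} out"
  shows "P = {{}, {v}}" "out = [{lab v}]"
proof -
  have v: "{v} \<in> P" using V by (auto simp: vertices_def)
  have "c = {} \<or> c = {v}" if "c \<in> P" for c
  proof -
    have "c \<subseteq> {v}"
      using cell_subset_if_vertices_subset[OF that v] V by blast
    then show ?thesis by blast
  qed
  then show P: "P = {{}, {v}}" using empty_cell v by blast
  then have "facets P = {{v}}" by (auto simp: facets_def)
  then have "set C = {{lab v}}" using C(2) V by (simp add: vertex_set_def)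
  then have "C = [{lab v}]"
    using C(1) by (metis distinct_length_2_or_more empty_iff insert_iff list.set_cases
        list.set_intros neq_Nil_conv singleton_iff set_empty insert_not_empty)
  with run have "face_iterator [{lab v}] [] {} out" by simp
  then show "out = [{lab v}]"
  proof cases
    case (step a D N1 N2 N out1 C' out2)
    have a: "a = {lab v}" using step(2) by simp
    have "N1 = {}" using step(3) a by auto
    then have "N = []" using step(4,6) by simp
    moreover have "set C' = {}" using step(9) a by auto
    then have "C' = []" by simp
    ultimately have "out1 = []" "out2 = []"
      using step(7,10) by (auto elim: face_iterator.cases)
    then show ?thesis using step(1) a by simp
  qed
qed

end

theorem corollary3p10:
  fixes X :: "'a topology" and P :: "'a set set" and d n :: nat
    and K :: "'a set \<Rightarrow> 'b::euclidean_space set" and \<phi> :: "'a set \<Rightarrow> 'b \<Rightarrow> 'a"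
    and lab :: "'a \<Rightarrow> nat" and C :: "nat set list"
  assumes "closed_manifold d X"
    and "finite P" and "polytopal_subdivision X P K \<phi>"
    and "bij_betw lab (vertices P) {1..n}"
    and "distinct C" and "set C = vertex_set lab P ` facets P"
  shows "(\<exists>out. face_iterator C [] {} out) \<and>
    (\<forall>out. face_iterator C [] {} out \<longrightarrow>
       (\<forall>c\<in>P. c \<noteq> {} \<or> n \<noteq> 1 \<longrightarrow> (\<exists>!i. i < length out \<and> out ! i = vertex_set lab P c)) \<and>
       (\<forall>i<length out. \<exists>!c. c \<in> P \<and> out ! i = vertex_set lab P c))"
proof (intro conjI allI ballI impI)
  interpret subdivided_space X P K \<phi>
    using assms(3) by unfold_locales
  have inj: "inj_on lab (vertices P)" using assms(4) by (rule bij_betw_imp_inj_on)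
  have card: "card (vertices P) = n" using bij_betw_same_card[OF assms(4)] by simp
  show "\<exists>out. face_iterator C [] {} out"
    by (rule face_iterator_run_exists[OF assms(5)])
  fix out assume run: "face_iterator C [] {} out"
  \<comment> \<open>Only \<open>n = 1\<close> is exceptional. For \<open>n = 0\<close> the empty
    face is the only cell and the general argument applies.\<close>
  have out: "distinct out \<and> set out \<subseteq> vertex_set lab P ` P \<and>
    (\<forall>c\<in>P. c \<noteq> {} \<or> n \<noteq> 1 \<longrightarrow> vertex_set lab P c \<in> set out)"
  proof (cases "n = 1")
    case True
    then obtain v where "vertices P = {v}" using card card_1_singletonE by blast
    then show ?thesis
      using face_iterator_single_vertex[OF _ assms(5,6) run] True by (auto simp: vertex_set_def)
  next
    case False
    then show ?thesis
      using face_iterator_visits_cells[OF assms(1,2) inj _ assms(5,6) run] card by auto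
  qed
  show "\<exists>!i. i < length out \<and> out ! i = vertex_set lab P c"
    if "c \<in> P" "c \<noteq> {} \<or> n \<noteq> 1" for c
  proof -
    have "vertex_set lab P c \<in> set out" using out that by blast
    then obtain i where i: "i < length out" "out ! i = vertex_set lab P c"
      by (auto simp: in_set_conv_nth)
    show ?thesis
    proof (rule ex1I[of _ i])
      show "i < length out \<and> out ! i = vertex_set lab P c" using i by simp
      show "j = i" if "j < length out \<and> out ! j = vertex_set lab P c" for j
        using nth_eq_iff_index_eq[of out j i] out that i by simp
    qed
  qed
  show "\<exists>!c. c \<in> P \<and> out ! i = vertex_set lab P c" if "i < length out" for i
  proof -
    have "out ! i \<in> vertex_set lab P ` P" using out that nth_mem by blast
    then obtain c where c: "c \<in> P" "out ! i = vertex_set lab P c" by blast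
    show ?thesis
    proof (rule ex1I[of _ c])
      show "c \<in> P \<and> out ! i = vertex_set lab P c" using c by simp
      show "c' = c" if "c' \<in> P \<and> out ! i = vertex_set lab P c'" for c'
        using inj_onD[OF vertex_set_inj[OF inj], of c' c] c that by simp
    qed
  qed
qed

end
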